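(* There exists an integer $N$ such that for every integer $n \geq N$ that is divisible by none of $2,3,5,7$, we have $\beta(G(B_n)) \leq n-1$.
   Context: The back circulant latin square $B_n$ is the latin square of order $n$ with rows, columns and symbols indexed by $[n]=\{1,\dots,n\}$ defined by $B_n[i,j] = i+j-1 \pmod n$, where the symbol $n$ is written in place of $0$. For a latin square $L$ of order $n$, the latin square graph $G(L)$ is the graph whose $n^2$ vertices are the cells of $L$, where two distinct cells are adjacent if they share a row, share a column, or contain the same symbol. The metric dimension $\beta(G)$ of a connected graph $G$ is the minimum number $m$ of vertices $u_1,\dots,u_m$ of $G$ such that every vertex $v$ of $G$ is uniquely determined by its vector of graph distances $(d(u_1,v),\dots,d(u_m,v))$. *)

theory Defs
  imports Main
begin

text \<open>A graph is given by a vertex set \<open>V\<close> and a symmetric irreflexive edge relation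
  \<open>E \<subseteq> V \<times> V\<close>. The graph distance is the least length of a walk; it is meaningful
  only for vertices of a common component.\<close>

definition graph_dist :: "'a rel \<Rightarrow> 'a \<Rightarrow> 'a \<Rightarrow> nat" where
  "graph_dist E u v = (LEAST k. (u, v) \<in> E ^^ k)"

definition resolving :: "'a set \<Rightarrow> 'a rel \<Rightarrow> 'a list \<Rightarrow> bool" where
  "resolving V E us \<longleftrightarrow>
     set us \<subseteq> V \<and> inj_on (\<lambda>v. map (\<lambda>u. graph_dist E u v) us) V"

definition metric_dimension :: "'a set \<Rightarrow> 'a rel \<Rightarrow> nat" where
  "metric_dimension V E = (LEAST m. \<exists>us. length us = m \<and> resolving V E us)"

definition latin_square :: "nat \<Rightarrow> (nat \<Rightarrow> nat \<Rightarrow> nat) \<Rightarrow> bool" where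
  "latin_square n L \<longleftrightarrow>
     (\<forall>i\<in>{1..n}. bij_betw (\<lambda>j. L i j) {1..n} {1..n}) \<and>
     (\<forall>j\<in>{1..n}. bij_betw (\<lambda>i. L i j) {1..n} {1..n})"

definition cells :: "nat \<Rightarrow> (nat \<times> nat) set" where
  "cells n = {1..n} \<times> {1..n}"

definition latin_edges :: "nat \<Rightarrow> (nat \<Rightarrow> nat \<Rightarrow> nat) \<Rightarrow> (nat \<times> nat) rel" where
  "latin_edges n L =
     {((i, j), (k, l)) | i j k l. (i, j) \<in> cells n \<and> (k, l) \<in> cells n \<and> (i, j) \<noteq> (k, l) \<and>
        (i = k \<or> j = l \<or> L i j = L k l)}"

definition back_circulant :: "nat \<Rightarrow> nat \<Rightarrow> nat \<Rightarrow> nat" where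
  "back_circulant n i j =
     (let s = (i + j - 1) mod n in if s = 0 then n else s)"

text \<open>The following facts show that the definitions are applied to a genuine latin square,
  and that both minima above are attained for its (connected) graph.\<close>

lemma back_circulant_inj:
  assumes "i \<in> {1..n}"
  shows "inj_on (\<lambda>j. back_circulant n i j) {1..n}"
proof -
  have aux: "j \<le> k \<Longrightarrow> j \<in> {1..n} \<Longrightarrow> k \<in> {1..n}
      \<Longrightarrow> back_circulant n i j = back_circulant n i k \<Longrightarrow> j = k" for j k
  proof -
    assume a: "j \<le> k" "j \<in> {1..n}" "k \<in> {1..n}"
      and e: "back_circulant n i j = back_circulant n i k"
    have n: "n > 0" using a by simp
    have lt: "(i + j - 1) mod n < n" "(i + k - 1) mod n < n" using n by simp_all
    have "(i + k - 1) mod n = (i + j - 1) mod n"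
      using e lt unfolding back_circulant_def Let_def by (metis less_irrefl)
    then have "n dvd (i + k - 1) - (i + j - 1)" using a(1)
      by (metis mod_eq_dvd_iff_nat diff_le_mono nat_add_left_cancel_le)
    moreover have "(i + k - 1) - (i + j - 1) = k - j" using a assms by auto
    ultimately have "n dvd k - j" by simp
    moreover have "k - j < n" using a by auto
    ultimately have "k - j = 0" by (metis nat_dvd_not_less neq0_conv)
    then show "j = k" using a(1) by simp
  qed
  show ?thesis
    by (rule inj_onI) (metis aux nle_le)
qed

lemma latin_square_back_circulant: "latin_square n (back_circulant n)"
proof -
  have sym: "back_circulant n i j = back_circulant n j i" for i j
    by (simp add: back_circulant_def add.commute)
  have "bij_betw (\<lambda>j. back_circulant n i j) {1..n} {1..n}" if i: "i \<in> {1..n}" for i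
  proof -
    have "(\<lambda>j. back_circulant n i j) ` {1..n} \<subseteq> {1..n}"
      using i by (auto simp: back_circulant_def Let_def less_imp_le)
    then show ?thesis
      using back_circulant_inj[OF i] by (simp add: bij_betw_def endo_inj_surj)
  qed
  then show ?thesis unfolding latin_square_def using sym by simp
qed

lemma latin_edges_connected:
  assumes "u \<in> cells n" "v \<in> cells n"
  shows "\<exists>k. (u, v) \<in> latin_edges n L ^^ k"
proof -
  obtain i j k l where uv: "u = (i, j)" "v = (k, l)" by fastforce
  have "(u, (i, l)) \<in> (latin_edges n L)\<^sup>*"
    using assms uv by (cases "j = l") (auto simp: latin_edges_def cells_def)
  moreover have "((i, l), v) \<in> (latin_edges n L)\<^sup>*"
    using assms uv by (cases "i = k") (auto simp: latin_edges_def cells_def)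
  ultimately show ?thesis by (metis rtrancl_trans rtrancl_imp_relpow)
qed

lemma latin_resolving_exists: "\<exists>us. resolving (cells n) (latin_edges n L) us"
proof -
  have fin: "finite (cells n)" by (simp add: cells_def)
  then obtain us where us: "set us = cells n" using finite_list by blast
  have "inj_on (\<lambda>v. map (\<lambda>u. graph_dist (latin_edges n L) u v) us) (cells n)"
  proof (rule inj_onI)
    fix v w assume vw: "v \<in> cells n" "w \<in> cells n"
      and eq: "map (\<lambda>u. graph_dist (latin_edges n L) u v) us
             = map (\<lambda>u. graph_dist (latin_edges n L) u w) us"
    have "graph_dist (latin_edges n L) v v = 0" by (simp add: graph_dist_def)
    then have "graph_dist (latin_edges n L) v w = 0" using eq vw us by auto
    moreover have "(v, w) \<in> latin_edges n L ^^ graph_dist (latin_edges n L) v w"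
      unfolding graph_dist_def by (rule LeastI_ex[OF latin_edges_connected[OF vw]])
    ultimately show "v = w" by simp
  qed
  then show ?thesis using us unfolding resolving_def by blast
qed

end

theory Submission
  imports Defs "HOL-Computational_Algebra.Primes"
begin

text \<open>For \<open>n\<close> coprime to 6 the cells with row \<open>t\<close>, column \<open>2t\<close> and symbol \<open>3t\<close> (modulo \<open>n\<close>, up to
  the common shift of the symbols) form a transversal. Any cell lies in the row of \<open>x\<close>, the
  column of \<open>y\<close> and the symbol class of \<open>z\<close> for unique transversal cells \<open>x, y, z\<close>, and
  \<open>x + 2y \<equiv> 3z\<close>. Off the transversal the three are distinct, and since 5 and 7 are invertible as
  well, the set \<open>{x, y, z}\<close> determines the triple: comparing the congruence with a permuted one
  yields \<open>c (x - y) \<equiv> 0\<close> or similar with \<open>c \<in> {1, 4, 5, 7}\<close>. Hence the transversal is resolving.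
  One of its cells can be dropped, because all these sets have exactly three elements, so that
  the missing one is detected by cardinality.\<close>

section \<open>Distances up to 1, and equality of symbols as a congruence\<close>

lemma relpow_graph_dist:
  assumes "\<exists>k. (u, v) \<in> E ^^ k"
  shows "(u, v) \<in> E ^^ graph_dist E u v"
  unfolding graph_dist_def using assms by (rule LeastI_ex)

lemma graph_dist_eq_0_iff:
  assumes "\<exists>k. (u, v) \<in> E ^^ k"
  shows "graph_dist E u v = 0 \<longleftrightarrow> u = v"
proof
  show "u = v" if "graph_dist E u v = 0"
    using relpow_graph_dist[OF assms] that by simp
qed (simp add: graph_dist_def)

lemma graph_dist_le_1_iff:
  assumes "\<exists>k. (u, v) \<in> E ^^ k"
  shows "graph_dist E u v \<le> 1 \<longleftrightarrow> u = v \<or> (u, v) \<in> E"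
proof
  assume "graph_dist E u v \<le> 1"
  then consider "graph_dist E u v = 0" | "graph_dist E u v = 1" by linarith
  then show "u = v \<or> (u, v) \<in> E"
    using relpow_graph_dist[OF assms] by cases simp_all
next
  assume "u = v \<or> (u, v) \<in> E"
  then have "(u, v) \<in> E ^^ 0 \<or> (u, v) \<in> E ^^ 1" by simp
  then show "graph_dist E u v \<le> 1"
    unfolding graph_dist_def by (metis Least_le le_trans zero_le_one)
qed

lemma back_circulant_eq_iff:
  assumes "n > 0" "i \<ge> 1" "k \<ge> 1"
  shows "back_circulant n i j = back_circulant n k l \<longleftrightarrow>
         int n dvd (int i + int j) - (int k + int l)"
proof -
  \<comment> \<open>Residues stay below \<open>n\<close>, so writing \<open>n\<close> for 0 merges
    no two symbols.\<close>
  have lt: "(i + j - 1) mod n < n" "(k + l - 1) mod n < n" using assms by simp_all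
  then have "back_circulant n i j = back_circulant n k l \<longleftrightarrow>
      (i + j - 1) mod n = (k + l - 1) mod n"
    unfolding back_circulant_def Let_def by (metis less_irrefl)
  also have "\<dots> \<longleftrightarrow> int (i + j - 1) mod int n = int (k + l - 1) mod int n"
    by (metis of_nat_eq_iff zmod_int)
  also have "\<dots> \<longleftrightarrow> int n dvd int (i + j - 1) - int (k + l - 1)"
    by (rule mod_eq_dvd_iff)
  also have "int (i + j - 1) - int (k + l - 1) = (int i + int j) - (int k + int l)"
    using assms by simp
  finally show ?thesis .
qed

text \<open>If \<open>a\<close> lay in only one of the sets, their cardinalities would differ by
  one. This makes up for the transversal cell that is left out.\<close>

lemma eq_if_Diff_singleton_eq_card_eq:
  assumes "finite A" "finite B" "A - {a} = B - {a}" "card A = card B"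
  shows "A = B"
proof -
  have "a \<in> A \<longleftrightarrow> a \<in> B"
    using assms card_Diff1_less[of A a] card_Diff1_less[of B a]
    by (metis Diff_empty Diff_insert0 less_irrefl)
  then show ?thesis using assms(3) by blast
qed

section \<open>Linear congruences with unit coefficients\<close>

lemma int_eq_if_dvd_mult_diff:
  fixes n :: int
  assumes "n dvd a * (x - y)" "coprime a n" "x \<in> {1..n}" "y \<in> {1..n}"
  shows "x = y"
proof -
  have "n dvd x - y"
    using assms(1,2) by (simp add: coprime_commute coprime_dvd_mult_right_iff)
  moreover have "\<bar>x - y\<bar> < n" using assms(3,4) by auto
  ultimately show ?thesis using dvd_imp_le_int[of "x - y" n] by auto
qed

lemma ex_residue_solution:
  fixes n :: int
  assumes "coprime a n" "n > 0"
  shows "\<exists>x\<in>{1..n}. n dvd a * x - b"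
proof -
  obtain u v where uv: "u * a + v * n = 1"
    using bezout_int[of a n] assms(1) by auto
  \<comment> \<open>Here \<open>u\<close> inverts \<open>a\<close> modulo \<open>n\<close>. Shifting
    by 1 around the reduction selects the representative of \<open>u * b\<close> in
    \<open>{1..n}\<close> instead of \<open>{0..<n}\<close>.\<close>
  define x where "x = (u * b - 1) mod n + 1"
  have "x \<in> {1..n}" unfolding x_def using assms(2)
    by (simp add: zless_imp_add1_zle)
  moreover have "n dvd (u * b - 1) mod n - (u * b - 1)"
    by (metis mod_eq_dvd_iff mod_mod_trivial)
  then have "n dvd x - u * b" by (simp add: x_def algebra_simps)
  then have "n dvd a * (x - u * b) - n * (v * b)" by simp
  moreover have "a * (x - u * b) - n * (v * b) = a * x - (u * a + v * n) * b"
    by (simp add: algebra_simps)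
  ultimately show ?thesis using uv by auto
qed

lemma weighted_triple_unique:
  fixes n :: int
  assumes cop: "coprime 2 n" "coprime 5 n" "coprime 7 n"
    and range: "{x, y, z} \<subseteq> {1..n}"
    and distinct: "x \<noteq> y" "x \<noteq> z" "y \<noteq> z"
    and eq: "n dvd x + 2 * y - 3 * z" "n dvd x' + 2 * y' - 3 * z'"
    and sets: "{x, y, z} = {x', y', z'}"
  shows "x = x' \<and> y = y'"
proof (rule ccontr)
  assume neq: "\<not> (x = x' \<and> y = y')"
  have cop4: "coprime 4 n"
    using cop(1) coprime_power_left_iff[of 2 2 n] by simp
  have r: "x \<in> {1..n}" "y \<in> {1..n}" "z \<in> {1..n}" using range by auto
  have mem: "x' \<in> {x, y, z}" "y' \<in> {x, y, z}" "z' \<in> {x, y, z}"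
    unfolding sets by simp_all
  have "card {x', y', z'} = 3" unfolding sets[symmetric] using distinct by simp
  then have distinct': "x' \<noteq> y'" "x' \<noteq> z'" "y' \<noteq> z'"
    by (auto simp: card_insert_if split: if_splits)
  \<comment> \<open>The five non-identity permutations: three transpositions, where subtracting the
    congruences cancels the fixed entry, then two 3-cycles.\<close>
  consider "x' = x" "y' = z" "z' = y" | "x' = y" "y' = x" "z' = z"
    | "x' = z" "y' = y" "z' = x" | "x' = y" "y' = z" "z' = x" | "x' = z" "y' = x" "z' = y"
    using mem distinct distinct' neq unfolding insert_iff empty_iff by argo
  then show False
  proof cases
    case 1
    have "n dvd 5 * (y - z)"
      using dvd_diff[OF eq] by (simp add: 1 algebra_simps)
    then show False using int_eq_if_dvd_mult_diff cop r distinct by blast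
  next
    case 2
    have "n dvd 1 * (y - x)"
      using dvd_diff[OF eq] by (simp add: 2 algebra_simps)
    then show False using int_eq_if_dvd_mult_diff[of n 1 y x] r distinct by simp
  next
    case 3
    have "n dvd 4 * (x - z)"
      using dvd_diff[OF eq] by (simp add: 3 algebra_simps)
    then show False using int_eq_if_dvd_mult_diff cop4 r distinct by blast
  next
    case 4
    \<comment> \<open>For a 3-cycle the plain difference keeps all three variables. The multipliers
      2 and 3 here, and 1 and 3 in the next case, are chosen to cancel \<open>z\<close>.\<close>
    have "n dvd 7 * (y - x)"
      using dvd_add[OF dvd_mult[OF eq(1), of 2] dvd_mult[OF eq(2), of 3]]
      by (simp add: 4 algebra_simps)
    then show False using int_eq_if_dvd_mult_diff cop r distinct by blast
  next
    case 5
    have "n dvd 7 * (x - y)"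
      using dvd_add[OF eq(1) dvd_mult[OF eq(2), of 3]]
      by (simp add: 5 algebra_simps)
    then show False using int_eq_if_dvd_mult_diff cop r distinct by blast
  qed
qed

section \<open>The doubling transversal and the coordinates of a cell relative to it\<close>

definition doubling_cell :: "nat \<Rightarrow> nat \<Rightarrow> nat \<times> nat" where
  "doubling_cell n t = (t, if 2 * t \<le> n then 2 * t else 2 * t - n)"

lemma doubling_cell_in_cells:
  "t \<in> {1..n} \<Longrightarrow> doubling_cell n t \<in> cells n"
  by (auto simp: doubling_cell_def cells_def)

lemma doubling_cell_column: "int n dvd 2 * int t - int (snd (doubling_cell n t))"
  by (auto simp: doubling_cell_def)

text \<open>The indices of the transversal cells sharing the row, column and symbol of
  \<open>v\<close>. Symbols are compared through row plus column, which is \<open>3 * z\<close> on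
  the transversal.\<close>

definition coordinates :: "nat \<Rightarrow> nat \<times> nat \<Rightarrow> int \<Rightarrow> int \<Rightarrow> int \<Rightarrow> bool" where
  "coordinates n v x y z \<longleftrightarrow> {x, y, z} \<subseteq> {1..int n} \<and> x = int (fst v) \<and>
     int n dvd 2 * y - int (snd v) \<and> int n dvd 3 * z - (int (fst v) + int (snd v))"

lemma ex_coordinates:
  assumes "coprime 2 (int n)" "coprime 3 (int n)" "v \<in> cells n"
  shows "\<exists>x y z. coordinates n v x y z"
proof -
  have x: "int (fst v) \<in> {1..int n}" using assms(3) by (auto simp: cells_def)
  then have n: "int n > 0" by auto
  obtain y z where "y \<in> {1..int n}" "int n dvd 2 * y - int (snd v)"
    "z \<in> {1..int n}" "int n dvd 3 * z - (int (fst v) + int (snd v))"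
    using ex_residue_solution[OF assms(1) n] ex_residue_solution[OF assms(2) n] by meson
  then have "coordinates n v (int (fst v)) y z" using x by (simp add: coordinates_def)
  then show ?thesis by blast
qed

text \<open>Subtracting the symbol congruence from the column congruence cancels the column of
  \<open>v\<close> and leaves its row, which is \<open>x\<close>.\<close>

lemma coordinates_equation:
  assumes "coordinates n v x y z"
  shows "int n dvd x + 2 * y - 3 * z"
proof -
  have "int n dvd (2 * y - int (snd v)) - (3 * z - (int (fst v) + int (snd v)))"
    using assms unfolding coordinates_def by (metis dvd_diff)
  then show ?thesis using assms by (simp add: coordinates_def algebra_simps)
qed

lemma cell_eq_if_same_column:
  assumes "int n dvd 2 * y - int (snd v)" "int n dvd 2 * y - int (snd w)"
    and "v \<in> cells n" "w \<in> cells n" "fst v = fst w"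
  shows "v = w"
proof -
  have "int n dvd 1 * (int (snd w) - int (snd v))"
    using dvd_diff[OF assms(1,2)] by simp
  then have "int (snd w) = int (snd v)"
    by (rule int_eq_if_dvd_mult_diff) (use assms(3,4) in \<open>auto simp: cells_def\<close>)
  then show ?thesis using assms(5) by (simp add: prod_eq_iff)
qed

text \<open>Identifying two coordinates in \<open>x + 2 * y - 3 * z\<close> leaves 3, 2 or 1 times a
  difference with the third, and these factors are units.\<close>

lemma coordinates_distinct_or_equal:
  assumes "coprime 2 (int n)" "coprime 3 (int n)" "coordinates n v x y z"
  shows "(x = y \<and> y = z) \<or> (x \<noteq> y \<and> x \<noteq> z \<and> y \<noteq> z)"
proof -
  note eq = coordinates_equation[OF assms(3)]
  have r: "x \<in> {1..int n}" "y \<in> {1..int n}" "z \<in> {1..int n}"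
    using assms(3) by (auto simp: coordinates_def)
  have "x = z" if "x = y"
    using int_eq_if_dvd_mult_diff[of "int n" 3 x z] that eq assms(2) r by simp
  moreover have "y = z" if "x = z"
    using int_eq_if_dvd_mult_diff[of "int n" 2 y z] that eq assms(1) r
    by (simp add: algebra_simps)
  moreover have "x = z" if "y = z"
    using int_eq_if_dvd_mult_diff[of "int n" 1 x z] that eq r by simp
  ultimately show ?thesis by blast
qed

lemma coordinates_diagonal:
  assumes "v \<in> cells n" "coordinates n v (int t) (int t) z"
  shows "v = doubling_cell n t"
proof (rule cell_eq_if_same_column)
  show "int n dvd 2 * int t - int (snd v)" using assms(2) unfolding coordinates_def by blast
  show "int n dvd 2 * int t - int (snd (doubling_cell n t))" by (rule doubling_cell_column)
  have "t \<in> {1..n}" using assms(2) by (simp add: coordinates_def)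
  then show "doubling_cell n t \<in> cells n" by (rule doubling_cell_in_cells)
  show "fst v = fst (doubling_cell n t)"
    using assms(2) by (simp add: coordinates_def doubling_cell_def)
qed (fact assms(1))

text \<open>This translates distance at most 1 into coordinates: a common row means
  \<open>int t = x\<close>, a common column gives \<open>int t = y\<close> after cancelling 2, a
  common symbol gives \<open>int t = z\<close> after cancelling 3.\<close>

lemma doubling_cell_adjacent_iff:
  assumes cop: "coprime 2 (int n)" "coprime 3 (int n)"
    and v: "v \<in> cells n" and c: "coordinates n v x y z" and t: "t \<in> {1..n}"
  shows "doubling_cell n t = v \<or> (doubling_cell n t, v) \<in> latin_edges n (back_circulant n)
     \<longleftrightarrow> int t \<in> {x, y, z}"
proof -
  obtain i j where ij: "v = (i, j)" by fastforce
  obtain d where d: "doubling_cell n t = (t, d)" by (simp add: doubling_cell_def)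
  have dc: "int n dvd 2 * int t - int d" using doubling_cell_column[of n t] d by simp
  have cell: "(t, d) \<in> cells n" using doubling_cell_in_cells[OF t] d by simp
  have y: "int n dvd 2 * y - int j" and z: "int n dvd 3 * z - (int i + int j)" and x: "x = int i"
    and r: "y \<in> {1..int n}" "z \<in> {1..int n}" "int t \<in> {1..int n}"
    using c t by (auto simp: coordinates_def ij)
  have n: "n > 0" "t \<ge> 1" "i \<ge> 1" using t v by (auto simp: ij cells_def)
  have col: "d = j \<longleftrightarrow> int t = y"
  proof
    assume "d = j"
    then have "int n dvd 2 * (int t - y)" using dvd_diff[OF dc y] by (simp add: algebra_simps)
    then show "int t = y" using int_eq_if_dvd_mult_diff cop r by blast
  next
    assume "int t = y"
    then have "int n dvd 1 * (int j - int d)" using dvd_diff[OF dc y] by simp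
    then have "int j = int d"
      by (rule int_eq_if_dvd_mult_diff) (use cell v in \<open>auto simp: cells_def ij\<close>)
    then show "d = j" by simp
  qed
  have sym: "back_circulant n t d = back_circulant n i j \<longleftrightarrow> int t = z"
  proof -
    have "back_circulant n t d = back_circulant n i j \<longleftrightarrow>
        int n dvd (int t + int d) - (int i + int j)"
      by (rule back_circulant_eq_iff[OF n])
    also have "\<dots> \<longleftrightarrow> int n dvd 3 * (int t - z)"
    proof -
      have "3 * (int t - z) =
          ((int t + int d) - (int i + int j)) + ((2 * int t - int d) - (3 * z - (int i + int j)))"
        by simp
      then show ?thesis using dvd_diff[OF dc z] by (metis dvd_add_left_iff)
    qed
    also have "\<dots> \<longleftrightarrow> int t = z"
      using int_eq_if_dvd_mult_diff[of "int n" 3 "int t" z] cop r by auto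
    finally show ?thesis .
  qed
  show ?thesis
    using v cell col sym x unfolding d ij latin_edges_def by auto
qed

section \<open>The transversal without its cell in row \<open>n\<close> is resolving\<close>

lemma resolving_doubling_cells:
  assumes cop: "coprime 2 (int n)" "coprime 3 (int n)" "coprime 5 (int n)" "coprime 7 (int n)"
  shows "resolving (cells n) (latin_edges n (back_circulant n)) (map (doubling_cell n) [1..<n])"
  unfolding resolving_def
proof (intro conjI inj_onI)
  show "set (map (doubling_cell n) [1..<n]) \<subseteq> cells n"
    using doubling_cell_in_cells by auto
next
  let ?E = "latin_edges n (back_circulant n)"
  let ?us = "map (doubling_cell n) [1..<n]"
  fix v w
  assume v: "v \<in> cells n" and w: "w \<in> cells n"
    and eq: "map (\<lambda>u. graph_dist ?E u v) ?us = map (\<lambda>u. graph_dist ?E u w) ?us"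
  have dist: "graph_dist ?E (doubling_cell n t) v = graph_dist ?E (doubling_cell n t) w"
    if "t \<in> {1..<n}" for t
    using eq that by simp
  have walk: "\<exists>k. (doubling_cell n t, u) \<in> ?E ^^ k" if "t \<in> {1..<n}" "u \<in> cells n" for t u
    using latin_edges_connected[OF doubling_cell_in_cells] that by simp
  have landmark: "doubling_cell n t = v \<longleftrightarrow> doubling_cell n t = w" if "t \<in> {1..<n}" for t
    using dist[OF that] graph_dist_eq_0_iff[OF walk[OF that]] v w by metis
  obtain x y z where xyz: "coordinates n v x y z" using ex_coordinates cop v by blast
  obtain x' y' z' where xyz': "coordinates n w x' y' z'" using ex_coordinates cop w by blast
  \<comment> \<open>Whether a distance is at most 1 reveals the coordinate set, except for
    membership of the index \<open>n\<close>, which has no landmark.\<close>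
  have iff: "int t \<in> {x, y, z} \<longleftrightarrow> int t \<in> {x', y', z'}" if t: "t \<in> {1..<n}" for t
  proof -
    have t': "t \<in> {1..n}" using t by simp
    show ?thesis
      using dist[OF t] graph_dist_le_1_iff[OF walk[OF t v]] graph_dist_le_1_iff[OF walk[OF t w]]
        doubling_cell_adjacent_iff[OF cop(1,2) v xyz t']
        doubling_cell_adjacent_iff[OF cop(1,2) w xyz' t'] by simp
  qed
  have range: "{x, y, z} \<subseteq> {1..int n}" "{x', y', z'} \<subseteq> {1..int n}"
    using xyz xyz' by (auto simp: coordinates_def)
  have most: "{x, y, z} - {int n} = {x', y', z'} - {int n}"
  proof -
    have *: "s \<in> {x, y, z} \<longleftrightarrow> s \<in> {x', y', z'}" if "s \<in> {1..int n}" "s \<noteq> int n" for s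
    proof -
      have "nat s \<in> {1..<n}" "int (nat s) = s" using that by auto
      then show ?thesis using iff by metis
    qed
    show ?thesis using * range by blast
  qed
  have diagonal: "a = doubling_cell n (nat p)" "nat p \<in> {1..n}"
    if "a \<in> cells n" "coordinates n a p q r" "p = q" for a p q r
  proof -
    have "p \<ge> 1" "p \<le> int n" using that(2) by (auto simp: coordinates_def)
    then show "a = doubling_cell n (nat p)" "nat p \<in> {1..n}"
      using coordinates_diagonal[of a n "nat p" r] that by auto
  qed
  note dv = coordinates_distinct_or_equal[OF cop(1,2) xyz]
  note dw = coordinates_distinct_or_equal[OF cop(1,2) xyz']
  show "v = w"
  proof (cases "\<exists>t\<in>{1..<n}. doubling_cell n t = v \<or> doubling_cell n t = w")
    case True
    then show ?thesis using landmark by metis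
  next
    case False
    \<comment> \<open>With neither cell a landmark, the dropped cell is the only transversal cell
      that \<open>v\<close> or \<open>w\<close> can be.\<close>
    have last: "a = doubling_cell n n \<and> p = int n"
      if "a \<in> cells n" "coordinates n a p q r" "p = q" "a = v \<or> a = w" for a p q r
    proof -
      have "nat p = n" using diagonal[OF that(1-3)] that(4) False by fastforce
      moreover have "p \<ge> 1" using that(2) by (auto simp: coordinates_def)
      ultimately show ?thesis using diagonal[OF that(1-3)] by auto
    qed
    consider "x = y" | "x' = y'" | "x \<noteq> y" "x' \<noteq> y'" by blast
    then show ?thesis
    proof cases
      case 1
      \<comment> \<open>Removing \<open>int n\<close> empties the coordinate set of
        \<open>v\<close>, so by \<open>most\<close> all coordinates of \<open>w\<close> are
        \<open>int n\<close> too, and \<open>w\<close> is the same dropped cell.\<close>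
      then have "v = doubling_cell n n" "{x, y, z} = {int n}" using last[OF v xyz] dv by auto
      moreover from this have "x' = y'" using most by auto
      ultimately show ?thesis using last[OF w xyz'] by simp
    next
      case 2
      then have "w = doubling_cell n n" "{x', y', z'} = {int n}" using last[OF w xyz'] dw by auto
      moreover from this have "x = y" using most by auto
      ultimately show ?thesis using last[OF v xyz] by simp
    next
      case 3
      then have "card {x, y, z} = 3" "card {x', y', z'} = 3" using dv dw by auto
      then have "{x, y, z} = {x', y', z'}"
        using eq_if_Diff_singleton_eq_card_eq[OF _ _ most] by simp
      moreover have "x \<noteq> y" "x \<noteq> z" "y \<noteq> z" using dv 3 by simp_all
      ultimately have xy: "x = x' \<and> y = y'"
        by (intro weighted_triple_unique[OF cop(1,3,4) range(1) _ _ _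
              coordinates_equation[OF xyz] coordinates_equation[OF xyz']])
      show ?thesis
        \<comment> \<open>The first coordinate is the row, and \<open>2 * y\<close> fixes the column
          modulo \<open>n\<close>.\<close>
        by (rule cell_eq_if_same_column[of n y])
          (use v w xyz xyz' xy in \<open>simp_all add: coordinates_def\<close>)
    qed
  qed
qed

theorem lemma3p6:
  "\<exists>N::nat. \<forall>n::nat. n \<ge> N \<and> \<not> 2 dvd n \<and> \<not> 3 dvd n \<and> \<not> 5 dvd n \<and> \<not> 7 dvd n
     \<longrightarrow> metric_dimension (cells n) (latin_edges n (back_circulant n)) \<le> n - 1"
proof (intro exI allI impI)
  fix n :: nat
  \<comment> \<open>The witness for \<open>N\<close> is 0; for \<open>n = 1\<close> the list of
    landmarks is empty and there is a single cell.\<close>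
  assume n: "n \<ge> 0 \<and> \<not> 2 dvd n \<and> \<not> 3 dvd n \<and> \<not> 5 dvd n \<and> \<not> 7 dvd n"
  have cop: "coprime (int p) (int n)" if "prime p" "\<not> p dvd n" for p
    using prime_imp_coprime[OF that] by simp
  have "coprime 2 (int n)" "coprime 3 (int n)" "coprime 5 (int n)" "coprime 7 (int n)"
    using n cop[of 2] cop[of 3] cop[of 5] cop[of 7] by simp_all
  then have "resolving (cells n) (latin_edges n (back_circulant n)) (map (doubling_cell n) [1..<n])"
    by (rule resolving_doubling_cells)
  then show "metric_dimension (cells n) (latin_edges n (back_circulant n)) \<le> n - 1"
    unfolding metric_dimension_def by (intro Least_le exI conjI) auto
qed

end
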